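(* Let $G=(V,E)$ be a directed graph on $n$ vertices with positive real capacities $w$, a designated source vertex $s$ and a designated sink vertex $t$. There is a data structure occupying $\mathcal{O}(n)$ space that, given any edge $e\in E$ and a value $\Delta\ge -w(e)$, reports in $\mathcal{O}(1)$ time the capacity of the $(s,t)$-mincut of the graph obtained from $G$ by changing the capacity of $e$ from $w(e)$ to $w(e)+\Delta$.
   Context: An $(s,t)$-cut is a set $C\subset V$ with $s\in C$, $t\notin C$; its capacity is the sum of capacities of edges from $C$ to $V\setminus C$; the $(s,t)$-mincut capacity is the minimum capacity of an $(s,t)$-cut. Space is measured in machine words. *)

theory Defs
  imports Complex_Main "Graph_Theory.Pair_Digraph"
begin

section \<open>Cuts in capacitated directed graphs\<close>

definition st_network :: "'a pair_pre_digraph \<Rightarrow> ('a \<times> 'a \<Rightarrow> real) \<Rightarrow> 'a \<Rightarrow> 'a \<Rightarrow> bool" where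
  "st_network G w s t \<longleftrightarrow>
     pair_fin_digraph G \<and> s \<in> pverts G \<and> t \<in> pverts G \<and> s \<noteq> t \<and> (\<forall>e\<in>parcs G. 0 < w e)"

definition st_cuts :: "'a pair_pre_digraph \<Rightarrow> 'a \<Rightarrow> 'a \<Rightarrow> 'a set set" where
  "st_cuts G s t = {C. C \<subseteq> pverts G \<and> s \<in> C \<and> t \<notin> C}"

definition cut_capacity :: "'a pair_pre_digraph \<Rightarrow> ('a \<times> 'a \<Rightarrow> real) \<Rightarrow> 'a set \<Rightarrow> real" where
  "cut_capacity G w C = (\<Sum>e \<in> {e \<in> parcs G. fst e \<in> C \<and> snd e \<in> pverts G - C}. w e)"

definition mincut_capacity :: "'a pair_pre_digraph \<Rightarrow> ('a \<times> 'a \<Rightarrow> real) \<Rightarrow> 'a \<Rightarrow> 'a \<Rightarrow> real" where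
  "mincut_capacity G w s t = Min (cut_capacity G w ` st_cuts G s t)"


section \<open>A word RAM with real-valued words\<close>

text \<open>
  A machine word holds either a bounded natural number or a real number.  The two kinds are
  kept apart: reals can only be copied, added, subtracted and compared, and there is no
  conversion between the kinds.  In particular there is no rounding, so a real word cannot be
  used to unpack an unbounded amount of discrete information.
\<close>

datatype mword = IntW nat | RealW real

text \<open>On integer words \<open>SubOp\<close> is truncated subtraction, and \<open>x div 0 = 0\<close>, \<open>x mod 0 = x\<close>.\<close>

datatype arith_op = AddOp | SubOp | MultOp | DivOp | ModOp

fun arith :: "arith_op \<Rightarrow> mword \<Rightarrow> mword \<Rightarrow> mword option" where
  "arith AddOp (IntW x) (IntW y) = Some (IntW (x + y))"
| "arith SubOp (IntW x) (IntW y) = Some (IntW (x - y))"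
| "arith MultOp (IntW x) (IntW y) = Some (IntW (x * y))"
| "arith DivOp (IntW x) (IntW y) = Some (IntW (x div y))"
| "arith ModOp (IntW x) (IntW y) = Some (IntW (x mod y))"
| "arith AddOp (RealW x) (RealW y) = Some (RealW (x + y))"
| "arith SubOp (RealW x) (RealW y) = Some (RealW (x - y))"
| "arith _ _ _ = None"

fun word_le :: "mword \<Rightarrow> mword \<Rightarrow> bool option" where
  "word_le (IntW x) (IntW y) = Some (x \<le> y)"
| "word_le (RealW x) (RealW y) = Some (x \<le> y)"
| "word_le _ _ = None"

text \<open>\<open>fits_word B x\<close>: integer words range over \<open>0, \<dots>, B - 1\<close>.\<close>

fun fits_word :: "nat \<Rightarrow> mword \<Rightarrow> bool" where
  "fits_word B (IntW x) \<longleftrightarrow> x < B"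
| "fits_word B (RealW x) \<longleftrightarrow> True"

text \<open>
  Registers are named by the numbers occurring in the program, so a program only uses a fixed
  finite number of them.  The memory is read-only; it is the data structure being queried.
\<close>

datatype instr =
    Const nat nat                \<comment> \<open>\<open>Const r x\<close>: \<open>r := x\<close>\<close>
  | Load nat nat                 \<comment> \<open>\<open>Load r a\<close>: \<open>r := memory[a]\<close>, the address being in register \<open>a\<close>\<close>
  | Arith arith_op nat nat nat   \<comment> \<open>\<open>Arith f r a b\<close>: \<open>r := f a b\<close>\<close>
  | JumpLe nat nat nat           \<comment> \<open>\<open>JumpLe a b l\<close>: go to instruction \<open>l\<close> if \<open>a \<le> b\<close>\<close>
  | Return nat

text \<open>
  \<open>run B mem P k pc regs\<close> executes at most \<open>k\<close> instructions of \<open>P\<close>, starting at position \<open>pc\<close>.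
  The result is \<open>None\<close> if no \<open>Return\<close> is executed within these \<open>k\<close> steps, or if the machine gets
  stuck: on an integer overflow (a value not below \<open>B\<close>), an address outside the memory, operands
  of the wrong kind, or a position outside the program.
\<close>

fun run :: "nat \<Rightarrow> mword list \<Rightarrow> instr list \<Rightarrow> nat \<Rightarrow> nat \<Rightarrow> (nat \<Rightarrow> mword) \<Rightarrow> mword option" where
  "run B mem P 0 pc regs = None"
| "run B mem P (Suc k) pc regs =
    (if pc < length P then
       (case P ! pc of
          Const r x \<Rightarrow>
            (if x < B then run B mem P k (pc + 1) (regs(r := IntW x)) else None)
        | Load r a \<Rightarrow>
            (case regs a of
               IntW i \<Rightarrow>
                 (if i < length mem then run B mem P k (pc + 1) (regs(r := mem ! i)) else None)
             | RealW _ \<Rightarrow> None)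
        | Arith f r a b \<Rightarrow>
            (case arith f (regs a) (regs b) of
               Some x \<Rightarrow>
                 (if fits_word B x then run B mem P k (pc + 1) (regs(r := x)) else None)
             | None \<Rightarrow> None)
        | JumpLe a b l \<Rightarrow>
            (case word_le (regs a) (regs b) of
               Some c \<Rightarrow> run B mem P k (if c then l else pc + 1) regs
             | None \<Rightarrow> None)
        | Return r \<Rightarrow> Some (regs r))
     else None)"

text \<open>
  A query starts with the numbers \<open>u\<close>, \<open>v\<close> of the endpoints of an edge and a real \<open>d\<close> in
  registers 0, 1 and 2; all other registers hold the integer 0.
\<close>

definition run_query ::
  "nat \<Rightarrow> mword list \<Rightarrow> instr list \<Rightarrow> nat \<Rightarrow> nat \<Rightarrow> nat \<Rightarrow> real \<Rightarrow> mword option" where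
  "run_query B mem P k u v d =
     run B mem P k 0 ((\<lambda>_. IntW 0)(0 := IntW u, 1 := IntW v, 2 := RealW d))"


section \<open>Sensitivity oracles\<close>

text \<open>
  The vertices are numbered \<open>0, \<dots>, n - 1\<close> by \<open>num\<close>, and an edge is passed to the query as the
  pair of numbers of its endpoints; its capacity is not part of the query.
  For \<open>B = n ^ b\<close> with constant \<open>b\<close>, integer words have \<open>O(log n)\<close> bits.
\<close>

definition mincut_sensitivity_oracle ::
  "nat \<Rightarrow> instr list \<Rightarrow> nat \<Rightarrow> 'a pair_pre_digraph \<Rightarrow> ('a \<times> 'a \<Rightarrow> real) \<Rightarrow> 'a \<Rightarrow> 'a \<Rightarrow>
   ('a \<Rightarrow> nat) \<Rightarrow> mword list \<Rightarrow> bool" where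
  "mincut_sensitivity_oracle B P k G w s t num mem \<longleftrightarrow>
     (\<forall>x\<in>set mem. fits_word B x) \<and>
     (\<forall>e\<in>parcs G. \<forall>\<Delta>\<ge>- w e.
        run_query B mem P k (num (fst e)) (num (snd e)) \<Delta> =
          Some (RealW (mincut_capacity G (w(e := w e + \<Delta>)) s t)))"

end

theory Submission
  imports Defs "HOL-Library.Nat_Bijection" "HOL-Library.Discrete_Functions"
begin

text \<open>
  Let \<open>f\<close> be the mincut capacity.  After changing \<open>e = (u, v)\<close> by \<open>\<Delta>\<close> the mincut capacity is
  \<open>min (A e) (B e + \<Delta>)\<close>, where \<open>A e\<close> and \<open>B e\<close> are the least capacities of cuts that \<open>e\<close> does not,
  respectively does, leave.  A cut is not left by \<open>e\<close> iff it avoids \<open>u\<close> or contains \<open>v\<close>, so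
  \<open>A e\<close> is a minimum of two numbers attached to \<open>u\<close> and \<open>v\<close>.

  Call \<open>e\<close> vital if \<open>B e < f + w e\<close>; otherwise the answer is always \<open>f\<close>.  By submodularity no vital
  edge enters a mincut for another vital edge.  Splitting the vertex set repeatedly by the mincuts
  for vital edges, in increasing order of capacity and always putting the source side first,
  gives a linear order with a number between each two consecutive vertices.  Vital edges go forward in
  it, and \<open>B e\<close> is the range minimum between the endpoints.  For a non-vital edge that goes forward,
  this range minimum, too, belongs to a cut that \<open>e\<close> leaves (or is a large default), so it is at
  least \<open>f + w e\<close> and does no harm: neither \<open>w e\<close> nor vitality has to be known to the query.  Range minima are answered
  with blocks of logarithmic length, a bit mask per position within the blocks, and a sparse table
  over the blocks.
\<close>

section \<open>Vital edges and their mincuts\<close>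

definition leaves :: "'a \<times> 'a \<Rightarrow> 'a set \<Rightarrow> bool" where
  "leaves e C \<longleftrightarrow> fst e \<in> C \<and> snd e \<notin> C"

definition separates :: "'a set \<Rightarrow> 'a \<Rightarrow> 'a \<Rightarrow> bool" where
  "separates C u v \<longleftrightarrow> (u \<in> C) \<noteq> (v \<in> C)"

locale st_net =
  fixes G :: "'a pair_pre_digraph" and w s t
  assumes net: "st_network G w s t"
begin

abbreviation "cap \<equiv> cut_capacity G w"
abbreviation "cuts \<equiv> st_cuts G s t"
abbreviation "fmin \<equiv> mincut_capacity G w s t"

lemma digraph: "pair_fin_digraph G"
  using net by (simp add: st_network_def)

lemma finite_verts: "finite (pverts G)"
  using digraph by (rule pair_fin_digraph.pair_finite_verts)

lemma finite_arcs: "finite (parcs G)"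
  using digraph by (rule pair_fin_digraph.pair_finite_arcs)

lemma s_vert: "s \<in> pverts G" and t_vert: "t \<in> pverts G" and s_neq_t: "s \<noteq> t"
  using net by (auto simp: st_network_def)

lemma w_pos: "e \<in> parcs G \<Longrightarrow> 0 < w e"
  using net by (auto simp: st_network_def)

lemma arc_verts: "e \<in> parcs G \<Longrightarrow> fst e \<in> pverts G \<and> snd e \<in> pverts G"
  using digraph pair_wf_digraph.arc_fst_in_verts pair_wf_digraph.arc_snd_in_verts
  by (metis pair_fin_digraph_def prod.collapse)

lemma finite_cuts: "finite cuts"
  using finite_verts by (auto simp: st_cuts_def intro: finite_subset[of _ "Pow (pverts G)"])

lemma cut_without: "u \<noteq> s \<Longrightarrow> \<exists>C\<in>cuts. u \<notin> C"
  using s_vert s_neq_t by (intro bexI[of _ "{s}"]) (auto simp: st_cuts_def)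

lemma cut_with: "v \<in> pverts G \<Longrightarrow> v \<noteq> t \<Longrightarrow> \<exists>C\<in>cuts. v \<in> C"
  using s_vert s_neq_t by (intro bexI[of _ "pverts G - {t}"]) (auto simp: st_cuts_def)

lemma cuts_nonempty: "cuts \<noteq> {}"
  using cut_without[of t] s_neq_t by auto

lemma fmin_le: "C \<in> cuts \<Longrightarrow> fmin \<le> cap C"
  by (simp add: mincut_capacity_def finite_cuts)

lemma fmin_attained: obtains C where "C \<in> cuts" "cap C = fmin"
proof -
  have "fmin \<in> cap ` cuts"
    unfolding mincut_capacity_def using finite_cuts cuts_nonempty by (intro Min_in) auto
  then show thesis using that by auto
qed

lemma capacity_eq_sum:
  "cut_capacity G w' C = (\<Sum>e\<in>parcs G. if leaves e C then w' e else 0)"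
proof -
  have "{e \<in> parcs G. fst e \<in> C \<and> snd e \<in> pverts G - C} = {e \<in> parcs G. leaves e C}"
    using arc_verts by (auto simp: leaves_def)
  then show ?thesis
    by (simp add: cut_capacity_def sum.inter_filter[OF finite_arcs])
qed

lemma capacity_change:
  assumes "e \<in> parcs G"
  shows "cut_capacity G (w(e := w e + d)) C = cap C + (if leaves e C then d else 0)"
proof -
  have "(if leaves x C then (w(e := w e + d)) x else 0) =
        (if leaves x C then w x else 0) + (if x = e then (if leaves e C then d else 0) else 0)" for x
    by simp
  then show ?thesis
    unfolding capacity_eq_sum by (simp only: sum.distrib) (simp add: finite_arcs assms)
qed

lemma cap_le_total: "cap C \<le> sum w (parcs G)"
  unfolding capacity_eq_sum by (intro sum_mono) (auto dest: w_pos)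

lemma fmin_nonneg: "0 \<le> fmin"
proof -
  obtain C where "cap C = fmin" by (rule fmin_attained)
  moreover have "0 \<le> cap C"
    unfolding capacity_eq_sum by (intro sum_nonneg) (auto dest: w_pos)
  ultimately show ?thesis by simp
qed

text \<open>The identity holds edge by edge: the extra sum collects the edges between
  \<open>C - C'\<close> and \<open>C' - C\<close>, which leave neither the intersection nor the
  union.\<close>

lemma submodular:
  "cap (C \<inter> C') + cap (C \<union> C') +
     sum w {e \<in> parcs G. leaves e C \<and> leaves (prod.swap e) C' \<or> leaves e C' \<and> leaves (prod.swap e) C}
   = cap C + cap C'"
  unfolding capacity_eq_sum sum.inter_filter[OF finite_arcs] sum.distrib[symmetric]
  by (intro sum.cong refl) (auto simp: leaves_def)

definition vital :: "'a \<times> 'a \<Rightarrow> bool" where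
  "vital e \<longleftrightarrow> e \<in> parcs G \<and> (\<exists>C\<in>cuts. leaves e C \<and> cap C < fmin + w e)"

definition mincut_for :: "'a \<times> 'a \<Rightarrow> 'a set \<Rightarrow> bool" where
  "mincut_for e C \<longleftrightarrow>
     C \<in> cuts \<and> leaves e C \<and> (\<forall>C'\<in>cuts. leaves e C' \<longrightarrow> cap C \<le> cap C')"

lemma mincut_forD: "mincut_for e C \<Longrightarrow> C \<in> cuts \<and> fst e \<in> C \<and> snd e \<notin> C"
  by (simp add: mincut_for_def leaves_def)

lemma vital_mincut_for:
  assumes "vital e"
  obtains C where "mincut_for e C" "cap C < fmin + w e"
proof -
  let ?S = "{C \<in> cuts. leaves e C}"
  obtain C0 where C0: "C0 \<in> ?S" "cap C0 < fmin + w e"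
    using assms by (auto simp: vital_def)
  have "finite ?S" "?S \<noteq> {}" using finite_cuts C0 by auto
  then obtain C where "is_arg_min cap (\<lambda>C. C \<in> ?S) C"
    using ex_is_arg_min_if_finite by blast
  then have "mincut_for e C" "cap C \<le> cap C0"
    using C0(1) by (force simp: is_arg_min_linorder mincut_for_def)+
  then show thesis using C0(2) that by simp
qed

text \<open>
  If \<open>e'\<close> entered \<open>C\<close>, uncrossing \<open>C\<close> with a minimum cut \<open>C'\<close> for \<open>e'\<close> would lose \<open>w e'\<close>
  (and \<open>w e\<close> too, if neither the intersection nor the union is left by \<open>e\<close>), which makes one of
  the two resulting cuts too small.
\<close>

lemma vital_not_entering:
  assumes e: "vital e" and C: "mincut_for e C" and e': "vital e'"
  shows "\<not> (fst e' \<notin> C \<and> snd e' \<in> C)"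
proof
  assume enter: "fst e' \<notin> C \<and> snd e' \<in> C"
  obtain C' where C': "mincut_for e' C'" "cap C' < fmin + w e'"
    using vital_mincut_for[OF e'] .
  have capC: "cap C < fmin + w e"
    using e C by (force simp: vital_def mincut_for_def)
  have cuts: "C \<inter> C' \<in> cuts" "C \<union> C' \<in> cuts"
    using C C'(1) by (auto simp: mincut_for_def st_cuts_def)
  note ge = fmin_le[OF cuts(1)] fmin_le[OF cuts(2)]
  let ?S = "{e \<in> parcs G. leaves e C \<and> leaves (prod.swap e) C' \<or> leaves e C' \<and> leaves (prod.swap e) C}"
  have S: "finite ?S" "e' \<in> ?S" "\<And>x. x \<in> ?S \<Longrightarrow> 0 \<le> w x"
    using finite_arcs e' enter C' w_pos by (auto simp: vital_def leaves_def mincut_for_def less_imp_le)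
  have le: "w e' \<le> sum w ?S"
    using S by (intro member_le_sum) auto
  have leC: "leaves e D \<Longrightarrow> D \<in> cuts \<Longrightarrow> cap C \<le> cap D" for D
    using C by (auto simp: mincut_for_def)
  show False
  proof (cases "leaves e (C \<inter> C') \<or> leaves e (C \<union> C')")
    case True
    then have "cap C \<le> cap (C \<inter> C') \<or> cap C \<le> cap (C \<union> C')"
      using leC cuts by blast
    then show False
      using submodular[of C C'] le ge C'(2) by linarith
  next
    case False
    \<comment> \<open>As \<open>e\<close> leaves \<open>C\<close> but neither the intersection nor
      the union, it runs from \<open>C - C'\<close> to \<open>C' - C\<close>, opposite to
      \<open>e'\<close>.\<close>
    then have "e \<in> ?S" "e \<noteq> e'"
      using e C enter by (auto simp: vital_def leaves_def mincut_for_def)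
    then have "sum w {e, e'} \<le> sum w ?S"
      using S by (intro sum_mono2) auto
    then show False
      using submodular[of C C'] ge C'(2) capC \<open>e \<noteq> e'\<close> by simp
  qed
qed

end

text \<open>
  The list \<open>xs\<close> arises by splitting \<open>K\<close> repeatedly by the sets of \<open>\<C>\<close>, in increasing order of \<open>f\<close>,
  the inside always being placed before the outside; \<open>D i\<close> is the value of the set that separates
  positions \<open>i\<close> and \<open>i + 1\<close>, or \<open>W\<close> if there is none.
\<close>

definition separation_order ::
  "('a set \<Rightarrow> real) \<Rightarrow> real \<Rightarrow> 'a set set \<Rightarrow> 'a set \<Rightarrow> 'a list \<Rightarrow> (nat \<Rightarrow> real) \<Rightarrow> bool" where
  "separation_order f W \<C> K xs D \<longleftrightarrow>
     distinct xs \<and> set xs = K \<and> (\<forall>i. D i \<in> insert W (f ` \<C>)) \<and>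
     (\<forall>i j. i < j \<longrightarrow> j < length xs \<longrightarrow>
       (\<forall>C\<in>\<C>. separates C (xs ! i) (xs ! j) \<longrightarrow> Min (D ` {i..<j}) \<le> f C) \<and>
       (Min (D ` {i..<j}) = W \<or>
        (\<exists>C\<in>\<C>. xs ! i \<in> C \<and> xs ! j \<notin> C \<and> Min (D ` {i..<j}) = f C)))"

lemma separation_orderD:
  assumes "separation_order f W \<C> K xs D" "i < j" "j < length xs"
  shows "\<And>C. C \<in> \<C> \<Longrightarrow> separates C (xs ! i) (xs ! j) \<Longrightarrow> Min (D ` {i..<j}) \<le> f C"
    and "Min (D ` {i..<j}) = W \<or>
         (\<exists>C\<in>\<C>. xs ! i \<in> C \<and> xs ! j \<notin> C \<and> Min (D ` {i..<j}) = f C)"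
  using assms by (auto simp: separation_order_def)

text \<open>Induction, cheapest set first: \<open>C\<close> splits \<open>K\<close>, and
  \<open>f C\<close>, a lower bound for all values, goes into the gap between the halves. Ranges
  across this gap have minimum \<open>f C\<close>; within a half \<open>C\<close> separates
  nothing.\<close>

lemma separation_order_list:
  fixes f :: "'a set \<Rightarrow> real"
  assumes "finite K" "sorted (map f Cs)" "\<forall>C\<in>set Cs. f C \<le> W"
  shows "\<exists>xs D. separation_order f W (set Cs) K xs D"
  using assms
proof (induction Cs arbitrary: K)
  case Nil
  then obtain xs where "set xs = K" "distinct xs"
    using finite_distinct_list by blast
  moreover have "Min ((\<lambda>_. W) ` {i..<j}) = W" if "i < j" for i j :: nat
    using that by (simp add: image_constant_conv)
  ultimately show ?case
    by (intro exI[of _ xs] exI[of _ "\<lambda>_. W"]) (simp add: separation_order_def)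
next
  case (Cons C Cs)
  have "sorted (map f Cs)" "\<forall>C\<in>set Cs. f C \<le> W" "finite (K \<inter> C)" "finite (K - C)"
    using Cons.prems by auto
  then obtain xs1 D1 xs2 D2 where
    IH1: "separation_order f W (set Cs) (K \<inter> C) xs1 D1" and
    IH2: "separation_order f W (set Cs) (K - C) xs2 D2"
    using Cons.IH by meson
  have xs1: "distinct xs1" "set xs1 = K \<inter> C" "D1 i \<in> insert W (f ` set Cs)" for i
    using IH1 by (auto simp: separation_order_def)
  have xs2: "distinct xs2" "set xs2 = K - C" "D2 i \<in> insert W (f ` set Cs)" for i
    using IH2 by (auto simp: separation_order_def)
  define l where "l = length xs1"
  define xs where "xs = xs1 @ xs2"
  define D where "D i = (if Suc i < l then D1 i else if Suc i = l then f C else D2 (i - l))" for i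
  have D_in: "D i \<in> insert W (f ` set (C # Cs))" for i
    using xs1(3)[of i] xs2(3)[of "i - l"] by (auto simp: D_def)
  have D_ge: "f C \<le> D i" for i
    using D_in[of i] Cons.prems(2,3) by auto
  have "(\<forall>X\<in>set (C # Cs). separates X (xs ! i) (xs ! j) \<longrightarrow> Min (D ` {i..<j}) \<le> f X) \<and>
       (Min (D ` {i..<j}) = W \<or>
        (\<exists>X\<in>set (C # Cs). xs ! i \<in> X \<and> xs ! j \<notin> X \<and> Min (D ` {i..<j}) = f X))"
    (is ?goal) if ij: "i < j" "j < length xs" for i j
  proof -
    consider "j < l" | "i < l" "l \<le> j" | "l \<le> i" by linarith
    then show ?goal
    proof cases
      case 1
      have eq: "D ` {i..<j} = D1 ` {i..<j}"
        using 1 by (intro image_cong) (auto simp: D_def)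
      have nth: "xs ! i = xs1 ! i" "xs ! j = xs1 ! j"
        using ij 1 by (auto simp: xs_def l_def nth_append)
      have l: "j < length xs1" using 1 by (simp add: l_def)
      have "xs ! i \<in> C" "xs ! j \<in> C"
        unfolding nth using ij l xs1(2) nth_mem[of i xs1] nth_mem[of j xs1] by auto
      then have "\<not> separates C (xs1 ! i) (xs1 ! j)"
        by (simp add: separates_def nth)
      then show ?thesis
        unfolding eq nth using separation_orderD[OF IH1 ij(1) l] by auto
    next
      case 2
      have "Min (D ` {i..<j}) = f C"
      proof (intro Min_eqI)
        show "f C \<in> D ` {i..<j}"
          using 2 by (intro image_eqI[of _ _ "l - 1"]) (auto simp: D_def)
      qed (use D_ge in auto)
      moreover have "xs ! i \<in> C" "xs ! j \<notin> C"
        using ij 2 xs1(2) xs2(2) nth_mem[of i xs1] nth_mem[of "j - l" xs2]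
        by (auto simp: xs_def l_def nth_append)
      ultimately show ?thesis
        using Cons.prems(2) by auto
    next
      case 3
      have "{i..<j} = (\<lambda>k. k + l) ` {i - l..<j - l}"
        using 3 ij by simp
      then have eq: "D ` {i..<j} = D2 ` {i - l..<j - l}"
        by (simp only: image_image) (simp add: D_def)
      have nth: "xs ! i = xs2 ! (i - l)" "xs ! j = xs2 ! (j - l)"
        using ij 3 by (auto simp: xs_def l_def nth_append)
      have l: "i - l < j - l" "j - l < length xs2" using ij 3 by (auto simp: xs_def l_def)
      have "xs ! i \<notin> C" "xs ! j \<notin> C"
        unfolding nth using l xs2(2) nth_mem[of "i - l" xs2] nth_mem[of "j - l" xs2] by auto
      then have "\<not> separates C (xs2 ! (i - l)) (xs2 ! (j - l))"
        by (simp add: separates_def nth)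
      then show ?thesis
        unfolding eq nth using separation_orderD[OF IH2 l] by auto
    qed
  qed
  moreover have "distinct xs" "set xs = K"
    using xs1(1,2) xs2(1,2) by (auto simp: xs_def)
  ultimately have "separation_order f W (set (C # Cs)) K xs D"
    using D_in unfolding separation_order_def by blast
  then show ?case by blast
qed

lemma separation_order_exists:
  fixes f :: "'a set \<Rightarrow> real"
  assumes "finite K" "finite \<C>" "\<forall>C\<in>\<C>. f C \<le> W"
  shows "\<exists>xs D. separation_order f W \<C> K xs D"
proof -
  obtain Cs where "set Cs = \<C>"
    using finite_list[OF assms(2)] by blast
  then show ?thesis
    using separation_order_list[of K f "sort_key f Cs" W] assms by simp
qed

section \<open>Mincut capacity after changing one edge\<close>

context st_net
begin

lemma nonvital_le: "e \<in> parcs G \<Longrightarrow> \<not> vital e \<Longrightarrow> C \<in> cuts \<Longrightarrow> leaves e C \<Longrightarrow> fmin + w e \<le> cap C"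
  by (force simp: vital_def)

text \<open>As \<open>w e > 0\<close>, a cut left by a nonvital edge costs more than
  \<open>fmin\<close>.\<close>

lemma nonvital_mincut:
  assumes "e \<in> parcs G" "\<not> vital e"
  obtains C where "C \<in> cuts" "\<not> leaves e C" "cap C = fmin"
proof -
  obtain C where C: "C \<in> cuts" "cap C = fmin" by (rule fmin_attained)
  moreover have "\<not> leaves e C"
    using nonvital_le[OF assms C(1)] w_pos[OF assms(1)] C(2) by auto
  ultimately show thesis using that by blast
qed

lemma mincut_capacityI:
  assumes "e \<in> parcs G"
    and "\<And>C. C \<in> cuts \<Longrightarrow> y \<le> cap C + (if leaves e C then d else 0)"
    and "C0 \<in> cuts" "cap C0 + (if leaves e C0 then d else 0) \<le> y"
  shows "mincut_capacity G (w(e := w e + d)) s t = y"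
  unfolding mincut_capacity_def
proof (rule Min_eqI)
  show "finite (cut_capacity G (w(e := w e + d)) ` cuts)"
    using finite_cuts by simp
  show "y \<le> z" if "z \<in> cut_capacity G (w(e := w e + d)) ` cuts" for z
    using that assms(2) by (auto simp: capacity_change[OF assms(1)])
  show "y \<in> cut_capacity G (w(e := w e + d)) ` cuts"
    using assms(3) assms(2)[OF assms(3)] assms(4)
    by (intro image_eqI[OF _ assms(3)]) (simp add: capacity_change[OF assms(1)])
qed

lemma mincut_capacity_nonvital:
  assumes "e \<in> parcs G" "\<not> vital e" "- w e \<le> d"
  shows "mincut_capacity G (w(e := w e + d)) s t = fmin"
proof -
  obtain C0 where C0: "C0 \<in> cuts" "\<not> leaves e C0" "cap C0 = fmin"
    using nonvital_mincut[OF assms(1,2)] .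
  have "fmin \<le> cap C + (if leaves e C then d else 0)" if "C \<in> cuts" for C
    using nonvital_le[OF assms(1,2) that] fmin_le[OF that] assms(3) by auto
  then show ?thesis
    using C0 by (intro mincut_capacityI[OF assms(1)]) auto
qed

definition min_excluding :: "'a \<Rightarrow> real" where
  "min_excluding u = Min (cap ` {C \<in> cuts. u \<notin> C})"

definition min_including :: "'a \<Rightarrow> real" where
  "min_including v = Min (cap ` {C \<in> cuts. v \<in> C})"

lemma min_excluding_le: "C \<in> cuts \<Longrightarrow> u \<notin> C \<Longrightarrow> min_excluding u \<le> cap C"
  by (simp add: min_excluding_def finite_cuts)

lemma min_including_le: "C \<in> cuts \<Longrightarrow> v \<in> C \<Longrightarrow> min_including v \<le> cap C"
  by (simp add: min_including_def finite_cuts)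

lemma min_excluding_attained:
  assumes "u \<noteq> s"
  obtains C where "C \<in> cuts" "u \<notin> C" "cap C = min_excluding u"
proof -
  have "min_excluding u \<in> cap ` {C \<in> cuts. u \<notin> C}"
    unfolding min_excluding_def using cut_without[OF assms] finite_cuts by (intro Min_in) auto
  then show thesis using that by auto
qed

lemma min_including_attained:
  assumes "v \<in> pverts G" "v \<noteq> t"
  obtains C where "C \<in> cuts" "v \<in> C" "cap C = min_including v"
proof -
  have "min_including v \<in> cap ` {C \<in> cuts. v \<in> C}"
    unfolding min_including_def using cut_with[OF assms] finite_cuts by (intro Min_in) auto
  then show thesis using that by auto
qed

text \<open>
  \<open>m\<close> is a substitute for the least capacity of a cut left by \<open>e\<close>.  If \<open>e\<close> is not vital it need
  not be the true value, but just so large that \<open>m + d\<close> can never fall below \<open>fmin\<close>.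
  No cut excludes \<open>s\<close> or includes \<open>t\<close>, so \<open>min_excluding s\<close> and \<open>min_including t\<close> are junk.
\<close>

lemma mincut_capacity_change:
  assumes e: "e \<in> parcs G" and d: "- w e \<le> d"
    and m_vital: "vital e \<Longrightarrow> \<exists>C. mincut_for e C \<and> m = cap C"
    and m_nonvital: "\<not> vital e \<Longrightarrow> fmin + w e \<le> m"
  defines "r \<equiv> if fst e = s then m + d else min (m + d) (min_excluding (fst e))"
  shows "mincut_capacity G (w(e := w e + d)) s t =
         (if snd e = t then r else min r (min_including (snd e)))" (is "_ = ?y")
proof -
  have y_le: "?y \<le> m + d" "fst e \<noteq> s \<Longrightarrow> ?y \<le> min_excluding (fst e)"
    "snd e \<noteq> t \<Longrightarrow> ?y \<le> min_including (snd e)"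
    by (auto simp: r_def)
  have y_cases: "?y = m + d \<or> fst e \<noteq> s \<and> ?y = min_excluding (fst e) \<or>
    snd e \<noteq> t \<and> ?y = min_including (snd e)"
    by (auto simp: r_def min_def)
  have not_leaves: "?y \<le> cap C" if "C \<in> cuts" "\<not> leaves e C" for C
  proof (cases "fst e \<in> C")
    case True
    then have "snd e \<in> C" using that by (auto simp: leaves_def)
    then have "snd e \<noteq> t" using that by (auto simp: st_cuts_def)
    then show ?thesis using y_le(3) min_including_le[OF that(1) \<open>snd e \<in> C\<close>] by linarith
  next
    case False
    then have "fst e \<noteq> s" using that by (auto simp: st_cuts_def)
    then show ?thesis using y_le(2) min_excluding_le[OF that(1) False] by linarith
  qed
  have lower: "?y \<le> cap C + (if leaves e C then d else 0)" if C: "C \<in> cuts" for C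
  proof (cases "leaves e C")
    case True
    show ?thesis
    proof (cases "vital e")
      case vital: True
      then have "m \<le> cap C" using m_vital C True by (auto simp: mincut_for_def)
      then show ?thesis using True y_le(1) by simp
    next
      case False
      \<comment> \<open>Bounding \<open>?y\<close> by \<open>fmin\<close> suffices: \<open>C\<close>
        costs at least \<open>fmin + w e\<close>, and \<open>d\<close> takes away at most
        \<open>w e\<close>.\<close>
      obtain C0 where "C0 \<in> cuts" "\<not> leaves e C0" "cap C0 = fmin"
        using nonvital_mincut[OF e False] .
      then have "?y \<le> fmin" using not_leaves by force
      then show ?thesis using nonvital_le[OF e False C True] d True by simp
    qed
  qed (simp add: not_leaves[OF C])
  have "\<exists>C0\<in>cuts. cap C0 + (if leaves e C0 then d else 0) \<le> ?y"
  proof -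
    consider (m) "?y = m + d" | (u) "fst e \<noteq> s" "?y = min_excluding (fst e)"
      | (v) "snd e \<noteq> t" "?y = min_including (snd e)"
      using y_cases by blast
    then show ?thesis
    proof cases
      case m
      show ?thesis
      proof (cases "vital e")
        case True
        then show ?thesis using m m_vital by (force simp: mincut_for_def)
      next
        case False
        obtain C0 where "C0 \<in> cuts" "\<not> leaves e C0" "cap C0 = fmin"
          using nonvital_mincut[OF e False] .
        then show ?thesis using m m_nonvital[OF False] d by (intro bexI[of _ C0]) auto
      qed
    next
      case u
      obtain C0 where "C0 \<in> cuts" "fst e \<notin> C0" "cap C0 = min_excluding (fst e)"
        using min_excluding_attained[OF u(1)] .
      then show ?thesis using u(2) by (intro bexI[of _ C0]) (auto simp: leaves_def)
    next
      case v
      obtain C0 where "C0 \<in> cuts" "snd e \<in> C0" "cap C0 = min_including (snd e)"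
        using min_including_attained v(1) arc_verts[OF e] by blast
      then show ?thesis using v(2) by (intro bexI[of _ C0]) (auto simp: leaves_def)
    qed
  qed
  then obtain C0 where C0: "C0 \<in> cuts" "cap C0 + (if leaves e C0 then d else 0) \<le> ?y" by blast
  show ?thesis
    by (rule mincut_capacityI[OF e _ C0]) (rule lower)
qed

text \<open>The order splits by all mincuts for vital edges. \<open>D i\<close> sits between
  positions \<open>i\<close> and \<open>i + 1\<close>, hence the half-open ranges.\<close>

lemma vertex_order:
  obtains pos :: "'a \<Rightarrow> nat" and D :: "nat \<Rightarrow> real" where
    "\<And>v. v \<in> pverts G \<Longrightarrow> pos v < card (pverts G)"
    "\<And>e. vital e \<Longrightarrow> pos (fst e) < pos (snd e)"
    "\<And>e. vital e \<Longrightarrow> \<exists>C. mincut_for e C \<and> Min (D ` {pos (fst e)..<pos (snd e)}) = cap C"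
    "\<And>e. e \<in> parcs G \<Longrightarrow> pos (fst e) < pos (snd e) \<Longrightarrow> \<not> vital e \<Longrightarrow>
       fmin + w e \<le> Min (D ` {pos (fst e)..<pos (snd e)})"
proof -
  define \<C> where "\<C> = {C. \<exists>e. vital e \<and> mincut_for e C}"
  \<comment> \<open>This default dominates every cut capacity, as the splitting requires, and every
    \<open>fmin + w e\<close>.\<close>
  define W where "W = fmin + sum w (parcs G)"
  have cuts: "\<C> \<subseteq> cuts" by (auto simp: \<C>_def mincut_for_def)
  then have "finite \<C>" using finite_cuts finite_subset by blast
  moreover have cap_le_W: "cap C \<le> W" for C
    using cap_le_total[of C] fmin_nonneg by (simp add: W_def)
  ultimately obtain xs D where ord: "separation_order cap W \<C> (pverts G) xs D"
    using separation_order_exists[of "pverts G" \<C> cap W] finite_verts by blast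
  then have xs: "distinct xs" "set xs = pverts G"
    by (auto simp: separation_order_def)
  define pos where "pos v = (THE i. i < length xs \<and> xs ! i = v)" for v
  have pos: "pos v < length xs" "xs ! pos v = v" if "v \<in> pverts G" for v
    using theI'[of "\<lambda>i. i < length xs \<and> xs ! i = v"] distinct_Ex1[OF xs(1)] that
    by (auto simp: pos_def xs(2))
  have sep: "\<And>C. C \<in> \<C> \<Longrightarrow> separates C u v \<Longrightarrow> Min (D ` {pos u..<pos v}) \<le> cap C"
    "Min (D ` {pos u..<pos v}) = W \<or>
      (\<exists>C\<in>\<C>. u \<in> C \<and> v \<notin> C \<and> Min (D ` {pos u..<pos v}) = cap C)"
    if "u \<in> pverts G" "v \<in> pverts G" "pos u < pos v" for u v
    using separation_orderD[OF ord that(3) pos(1)[OF that(2)]] pos(2)[OF that(1)] pos(2)[OF that(2)]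
    by auto
  have pos_less: "pos (fst e) < pos (snd e)" if e: "vital e" for e
  proof (rule ccontr)
    assume neg: "\<not> pos (fst e) < pos (snd e)"
    obtain C where C: "mincut_for e C" "cap C < fmin + w e" using vital_mincut_for[OF e] .
    have verts: "fst e \<in> pverts G" "snd e \<in> pverts G" "e \<in> parcs G"
      using e arc_verts by (auto simp: vital_def)
    have "fst e \<noteq> snd e" using mincut_forD[OF C(1)] by metis
    then have "pos (fst e) \<noteq> pos (snd e)" using pos(2) verts by metis
    \<comment> \<open>The range minimum is now at most \<open>cap C\<close>, hence below
      \<open>W\<close>, so it comes from a mincut for a vital edge that \<open>e\<close>
      enters.\<close>
    then have less: "pos (snd e) < pos (fst e)" using neg by simp
    have "C \<in> \<C>" using e C unfolding \<C>_def by blast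
    moreover have "separates C (snd e) (fst e)"
      using mincut_forD[OF C(1)] by (simp add: separates_def)
    ultimately have "Min (D ` {pos (snd e)..<pos (fst e)}) \<le> cap C"
      by (rule sep(1)[OF verts(2,1) less])
    moreover have "w e \<le> sum w (parcs G)"
      using verts finite_arcs w_pos by (intro member_le_sum) (auto simp: less_imp_le)
    ultimately have "Min (D ` {pos (snd e)..<pos (fst e)}) \<noteq> W"
      using C(2) by (simp add: W_def)
    then obtain C' where "C' \<in> \<C>" "snd e \<in> C'" "fst e \<notin> C'"
      using sep(2)[OF verts(2,1) less] by blast
    then show False
      using vital_not_entering e unfolding \<C>_def by blast
  qed
  show thesis
  proof (rule that[of pos D])
    show "pos v < card (pverts G)" if "v \<in> pverts G" for v
      using pos(1)[OF that] distinct_card[OF xs(1)] xs(2) by simp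
    show "pos (fst e) < pos (snd e)" if "vital e" for e
      by (rule pos_less[OF that])
    show "\<exists>C. mincut_for e C \<and> Min (D ` {pos (fst e)..<pos (snd e)}) = cap C" if e: "vital e" for e
    proof -
      obtain C where C: "mincut_for e C" using vital_mincut_for[OF e] .
      have verts: "fst e \<in> pverts G" "snd e \<in> pverts G"
        using e arc_verts by (auto simp: vital_def)
      have "C \<in> \<C>" using e C unfolding \<C>_def by blast
      moreover have "separates C (fst e) (snd e)"
        using mincut_forD[OF C] by (simp add: separates_def)
      ultimately have "Min (D ` {pos (fst e)..<pos (snd e)}) \<le> cap C"
        by (rule sep(1)[OF verts pos_less[OF e]])
      moreover have "cap C \<le> cap C'" if "C' \<in> \<C>" "fst e \<in> C'" "snd e \<notin> C'" for C'
        using that C cuts unfolding mincut_for_def leaves_def by blast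
      then have "cap C \<le> Min (D ` {pos (fst e)..<pos (snd e)})"
        using sep(2)[OF verts pos_less[OF e]] cap_le_W[of C] by metis
      ultimately show ?thesis using C by (intro exI[of _ C]) simp
    qed
    show "fmin + w e \<le> Min (D ` {pos (fst e)..<pos (snd e)})"
      if e: "e \<in> parcs G" "pos (fst e) < pos (snd e)" "\<not> vital e" for e
    proof -
      have "w e \<le> sum w (parcs G)"
        using e finite_arcs w_pos by (intro member_le_sum) (auto simp: less_imp_le)
      then have "fmin + w e \<le> W" by (simp add: W_def)
      moreover have "fmin + w e \<le> cap C" if "C \<in> \<C>" "fst e \<in> C" "snd e \<notin> C" for C
        using nonvital_le[OF e(1,3)] that cuts by (auto simp: leaves_def)
      ultimately show ?thesis
        using sep(2)[of "fst e" "snd e"] arc_verts[OF e(1)] e(2) by metis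
    qed
  qed
qed

end

section \<open>Loop-free programs as decision trees\<close>

datatype tree =
    TConst nat nat tree
  | TLoad nat nat tree
  | TArith arith_op nat nat nat tree
  | TIf nat nat tree tree
  | TReturn nat

fun sem :: "nat \<Rightarrow> mword list \<Rightarrow> tree \<Rightarrow> (nat \<Rightarrow> mword) \<Rightarrow> mword option" where
  "sem B mem (TConst r x p) regs = (if x < B then sem B mem p (regs(r := IntW x)) else None)"
| "sem B mem (TLoad r a p) regs =
    (case regs a of
       IntW i \<Rightarrow> if i < length mem then sem B mem p (regs(r := mem ! i)) else None
     | RealW _ \<Rightarrow> None)"
| "sem B mem (TArith f r a b p) regs =
    (case arith f (regs a) (regs b) of
       Some x \<Rightarrow> if fits_word B x then sem B mem p (regs(r := x)) else None
     | None \<Rightarrow> None)"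
| "sem B mem (TIf a b p q) regs =
    (case word_le (regs a) (regs b) of
       Some c \<Rightarrow> sem B mem (if c then p else q) regs
     | None \<Rightarrow> None)"
| "sem B mem (TReturn r) regs = Some (regs r)"

text \<open>\<open>compile l p\<close> is the code of \<open>p\<close>, to be placed at position \<open>l\<close>.\<close>

fun compile :: "nat \<Rightarrow> tree \<Rightarrow> instr list" where
  "compile l (TConst r x p) = Const r x # compile (l + 1) p"
| "compile l (TLoad r a p) = Load r a # compile (l + 1) p"
| "compile l (TArith f r a b p) = Arith f r a b # compile (l + 1) p"
| "compile l (TIf a b p q) =
    (let Q = compile (l + 1) q; l' = l + 1 + length Q in JumpLe a b l' # Q @ compile l' p)"
| "compile l (TReturn r) = [Return r]"

text \<open>Each instruction descends one level in the tree, so at most \<open>size p\<close> steps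
  precede the \<open>Return\<close>. The surrounding code is arbitrary because the branches of
  \<open>TIf\<close> surround each other.\<close>

lemma run_compile:
  "size p < k \<Longrightarrow> run B mem (P1 @ compile (length P1) p @ P2) k (length P1) regs = sem B mem p regs"
proof (induction p arbitrary: k P1 P2 regs)
  case (TConst r x p)
  then obtain k' where "k = Suc k'" "size p < k'" by (cases k) auto
  then show ?case
    using TConst.IH[of k' "P1 @ [Const r x]" P2] by (simp add: nth_append)
next
  case (TLoad r a p)
  then obtain k' where "k = Suc k'" "size p < k'" by (cases k) auto
  then show ?case
    using TLoad.IH[of k' "P1 @ [Load r a]" P2] by (simp add: nth_append split: mword.split)
next
  case (TArith f r a b p)
  then obtain k' where "k = Suc k'" "size p < k'" by (cases k) auto
  then show ?case
    using TArith.IH[of k' "P1 @ [Arith f r a b]" P2] by (simp add: nth_append split: option.split)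
next
  case (TIf a b p q)
  then obtain k' where k': "k = Suc k'" "size p < k'" "size q < k'" by (cases k) auto
  define Q where "Q = compile (length P1 + 1) q"
  define J where "J = JumpLe a b (length P1 + 1 + length Q)"
  have "run B mem ((P1 @ J # Q) @ compile (length (P1 @ J # Q)) p @ P2) k' (length (P1 @ J # Q)) regs =
        sem B mem p regs"
    by (rule TIf.IH(1)[OF k'(2)])
  moreover have "run B mem ((P1 @ [J]) @ compile (length (P1 @ [J])) q @
        (compile (length (P1 @ J # Q)) p @ P2)) k' (length (P1 @ [J])) regs =
        sem B mem q regs"
    by (rule TIf.IH(2)[OF k'(3)])
  ultimately show ?case
    by (auto simp: k'(1) nth_append Let_def Q_def[symmetric] J_def[symmetric] split: option.split)
      (auto simp: Q_def J_def)
next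
  case (TReturn r)
  then obtain k' where "k = Suc k'" by (cases k) auto
  then show ?case by (simp add: nth_append)
qed

text \<open>Register 31 is scratch.  \<open>fetch r i f\<close> reads field \<open>f\<close> of the 16-word record number \<open>i\<close>.\<close>

definition fetch :: "nat \<Rightarrow> nat \<Rightarrow> nat \<Rightarrow> tree \<Rightarrow> tree" where
  "fetch r i f p =
    TConst r 16 (TArith MultOp r i r (TConst 31 f (TArith AddOp r r 31 (TLoad r r p))))"

text \<open>Copying is done by arithmetic: \<open>a - a\<close> is a real zero, and adding
  \<open>a\<close> to it overwrites \<open>r\<close>.\<close>

definition min_into :: "nat \<Rightarrow> nat \<Rightarrow> tree \<Rightarrow> tree" where
  "min_into r a p = TArith SubOp 31 a a (TIf r a p (TArith AddOp r a 31 p))"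

lemma sem_min_into:
  assumes "regs r = RealW x" "regs a = RealW y" "r \<noteq> 31" "a \<noteq> 31"
  shows "sem B mem (min_into r a p) regs = sem B mem p (regs(31 := RealW 0, r := RealW (min x y)))"
proof (cases "x \<le> y")
  case True
  then have "regs(31 := RealW 0) = regs(31 := RealW 0, r := RealW (min x y))"
    using assms by auto
  then show ?thesis using assms True by (simp add: min_into_def)
qed (use assms in \<open>simp add: min_into_def min_def\<close>)

section \<open>Range minima\<close>

definition rmin :: "(nat \<Rightarrow> real) \<Rightarrow> nat \<Rightarrow> nat \<Rightarrow> real" where
  "rmin D i j = Min (D ` {i..j})"

lemma rmin_le: "i \<le> p \<Longrightarrow> p \<le> j \<Longrightarrow> rmin D i j \<le> D p"
  by (simp add: rmin_def)

text \<open>Overlap of the two ranges is harmless, which the sparse table exploits.\<close>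

lemma rmin_cover:
  assumes "i \<le> k" "k \<le> j" "i \<le> l" "l \<le> j" "l \<le> Suc k"
  shows "rmin D i j = min (rmin D i k) (rmin D l j)"
proof -
  have "{i..j} = {i..k} \<union> {l..j}" using assms by auto
  then show ?thesis
    unfolding rmin_def using assms by (simp only: image_Un) (simp add: Min_Un)
qed

text \<open>
  Offsets, within the block of \<open>j\<close>, of the positions that carry a minimum of the range from there
  to \<open>j\<close>.  The first of them at or after \<open>i\<close> is a minimum of the range from \<open>i\<close> to \<open>j\<close>.
\<close>

definition minima :: "nat \<Rightarrow> (nat \<Rightarrow> real) \<Rightarrow> nat \<Rightarrow> nat set" where
  "minima L D j = {a. j div L * L + a \<le> j \<and> (\<forall>p\<in>{j div L * L + a..j}. D (j div L * L + a) \<le> D p)}"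

definition lowest_bit :: "nat \<Rightarrow> nat" where
  "lowest_bit m = (LEAST k. odd (m div 2 ^ k))"

lemma minima_subset: "0 < L \<Longrightarrow> minima L D j \<subseteq> {..<L}"
proof
  fix a
  assume "0 < L" "a \<in> minima L D j"
  then have "j div L * L + a \<le> j" "j mod L < L"
    by (simp_all add: minima_def)
  then show "a \<in> {..<L}"
    using div_mult_mod_eq[of j L] unfolding lessThan_iff by linarith
qed

lemma set_encode_less: "A \<subseteq> {..<L} \<Longrightarrow> set_encode A < 2 ^ L"
proof -
  assume "A \<subseteq> {..<L}"
  then have "set_encode A \<le> sum ((^) 2) {..<L}"
    unfolding set_encode_def by (intro sum_mono2) auto
  also have "\<dots> < 2 ^ L"
    by (induction L) simp_all
  finally show ?thesis .
qed

text \<open>Division by the power of two drops the mask bits before \<open>i\<close>. A minimum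
  position \<open>q0\<close> of the range keeps its bit, so the lowest remaining bit
  \<open>q\<close> is at most \<open>q0\<close>, and membership in \<open>minima\<close> gives
  \<open>D q \<le> D q0\<close>.\<close>

lemma lowest_bit_minima:
  fixes D :: "nat \<Rightarrow> real"
  assumes L: "0 < L" and ij: "i \<le> j" "i div L = j div L"
    and q_def: "q = i + lowest_bit (set_encode (minima L D j) div 2 ^ (i mod L))"
  shows "q \<le> j \<and> D q = rmin D i j"
proof -
  let ?l = "j div L * L" and ?S = "minima L D j"
  have i: "i = ?l + i mod L" using ij(2) by (metis div_mult_mod_eq)
  have S: "finite ?S" using minima_subset[OF L] finite_subset by blast
  have odd_iff: "odd (set_encode ?S div 2 ^ (i mod L) div 2 ^ k) \<longleftrightarrow> i mod L + k \<in> ?S" for k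
    using set_encode_inverse[OF S]
    by (auto simp: set_decode_def div_mult2_eq[symmetric] power_add[symmetric])
  have "rmin D i j \<in> D ` {i..j}"
    unfolding rmin_def using ij(1) by (intro Min_in) auto
  then obtain q0 where q0: "i \<le> q0" "q0 \<le> j" "D q0 = rmin D i j" by auto
  have "?l + (i mod L + (q0 - i)) = q0" using q0 i by linarith
  then have "i mod L + (q0 - i) \<in> ?S"
    using q0 rmin_le[of i _ j D] by (simp add: minima_def)
  then have *: "i mod L + lowest_bit (set_encode ?S div 2 ^ (i mod L)) \<in> ?S"
    "lowest_bit (set_encode ?S div 2 ^ (i mod L)) \<le> q0 - i"
    unfolding lowest_bit_def odd_iff by (auto intro: LeastI Least_le)
  have q: "q = ?l + (i mod L + lowest_bit (set_encode ?S div 2 ^ (i mod L)))"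
    using i by (simp add: q_def)
  have min_q: "q \<le> j" "\<forall>p\<in>{q..j}. D q \<le> D p"
    unfolding q using *(1) by (simp_all add: minima_def)
  have "i \<le> q" "q \<le> q0" using *(2) q0 by (simp_all add: q_def)
  then have "D q \<le> rmin D i j" "rmin D i j \<le> D q"
    using bspec[OF min_q(2), of q0] rmin_le[of i q j D] min_q(1) q0 by simp_all
  then show ?thesis using min_q(1) by simp
qed

section \<open>The data structure and its query\<close>

text \<open>
  With \<open>q\<close> the block of \<open>i\<close> and \<open>k\<close> the offset of \<open>i\<close>, the entry at \<open>i\<close> is the minimum over the
  \<open>2 ^ k\<close> blocks from \<open>q\<close> on.  As only exponents below the block length \<open>L\<close> are needed, this
  sparse table over blocks fits in one word per position.
\<close>

definition block_range_min :: "nat \<Rightarrow> (nat \<Rightarrow> real) \<Rightarrow> nat \<Rightarrow> real" where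
  "block_range_min L D i = rmin D (i div L * L) ((i div L + 2 ^ (i mod L)) * L - 1)"

text \<open>
  Registers 0 to 2 keep the input, 3 and 4 hold the ends of the range, 5 the result, 6 the constant 1,
  7 the block length, and 8 and 9 the blocks of the ends.  Field numbers refer to \<open>entry\<close> below.
\<close>

definition finish :: tree where
  "finish =
    (let include_v = fetch 10 1 13 (TIf 6 10 (TReturn 5) (fetch 10 1 14 (min_into 5 10 (TReturn 5))))
     in TArith AddOp 5 5 2
          (fetch 10 0 11 (TIf 6 10 include_v (fetch 10 0 12 (min_into 5 10 include_v)))))"

definition same_block :: tree where
  "same_block =
    fetch 10 4 3 (TArith ModOp 11 3 7 (fetch 12 11 4 (TArith DivOp 10 10 12
      (fetch 11 10 5 (TArith AddOp 11 3 11 (fetch 5 11 2 finish))))))"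

text \<open>The rest of the first block, the start of the last one, and, if whole blocks lie
  between, two overlapping windows of \<open>2 ^ k\<close> blocks covering them.\<close>

definition across_blocks :: tree where
  "across_blocks =
    fetch 5 3 7 (fetch 10 4 8 (min_into 5 10 (TArith AddOp 8 8 6 (TIf 9 8 finish
      (TArith SubOp 11 9 8 (fetch 12 11 6 (fetch 13 12 4 (TArith SubOp 13 9 13
        (TArith MultOp 8 8 7 (TArith AddOp 8 8 12 (fetch 10 8 9 (min_into 5 10
          (TArith MultOp 13 13 7 (TArith AddOp 13 13 12 (fetch 10 13 9 (min_into 5 10 finish)
      )))))))))))))))"

definition query :: tree where
  "query =
    fetch 3 0 1 (fetch 4 1 1 (TIf 4 3 (fetch 5 0 10 (TReturn 5))
      (TConst 6 1 (TArith SubOp 4 4 6 (fetch 7 0 0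
        (TArith DivOp 8 3 7 (TArith DivOp 9 4 7 (TIf 9 8 same_block across_blocks))))))))"

text \<open>\<open>pos\<close>, the flags, \<open>a\<close> and \<open>b\<close> are indexed by
  vertex number, \<open>D\<close> by position in the order.\<close>

locale tables =
  fixes n :: nat and pos :: "nat \<Rightarrow> nat" and D :: "nat \<Rightarrow> real" and f0 :: real
    and is_s is_t :: "nat \<Rightarrow> bool" and a b :: "nat \<Rightarrow> real"
  assumes n_ge_2: "2 \<le> n" and pos_less: "\<And>i. i < n \<Longrightarrow> pos i < n"
begin

text \<open>As \<open>2 ^ L \<le> n\<close>, a block mask is itself a valid record number, so its
  lowest bit can be looked up.\<close>

definition L :: nat where "L = floor_log n"

text \<open>\<open>lowest_bit 0\<close> is unspecified; the reduction modulo \<open>n\<close> merely makes it fit into a word.\<close>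

definition entry :: "nat \<Rightarrow> mword list" where
  "entry i =
    [IntW L, IntW (pos i), RealW (D i), IntW (set_encode (minima L D i)),
     IntW (if i < L then 2 ^ i else 0), IntW (lowest_bit i mod n), IntW (floor_log i),
     RealW (rmin D i (i div L * L + (L - 1))), RealW (rmin D (i div L * L) i),
     RealW (block_range_min L D i), RealW f0,
     IntW (of_bool (is_s i)), RealW (a i), IntW (of_bool (is_t i)), RealW (b i), IntW 0]"

definition mem :: "mword list" where
  "mem = map (\<lambda>x. entry (x div 16) ! (x mod 16)) [0..<16 * n]"

abbreviation "B \<equiv> n ^ 5"

lemma length_mem: "length mem = 16 * n"
  by (simp add: mem_def)

text \<open>The exponent 5 is tight at \<open>n = 2\<close>, where
  \<open>16 * n = 2 ^ 5\<close>.\<close>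

lemma B_ge: "16 * n \<le> B" "32 \<le> B"
proof -
  have "2 ^ 4 * n \<le> n ^ 4 * n"
    using n_ge_2 by (intro mult_right_mono power_mono) auto
  moreover have "n ^ 4 * n = B" by (simp add: eval_nat_numeral)
  ultimately show "16 * n \<le> B" by simp
  then show "32 \<le> B" using n_ge_2 by simp
qed

lemma L_pos: "0 < L"
  unfolding L_def by (subst floor_log_rec[OF n_ge_2]) simp

lemma two_L_le: "2 ^ L \<le> n"
  using n_ge_2 by (simp add: L_def floor_log_exp2_le)

lemma n_less_two_L: "n < 2 * 2 ^ L"
  by (simp add: L_def floor_log_exp2_gt)

lemma L_less: "L < n"
  using two_L_le less_exp[of L] by linarith

lemma sem_fetch:
  assumes "regs i = IntW x" "x < n" "f < 16" "i \<noteq> r" "i \<noteq> 31" "r \<noteq> 31"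
  shows "sem B mem (fetch r i f p) regs = sem B mem p (regs(31 := IntW f, r := entry x ! f))"
proof -
  have "x * 16 + f < 16 * n" using assms(2,3) by linarith
  moreover have "mem ! (x * 16 + f) = entry x ! f"
    using calculation assms(3) by (simp add: mem_def)
  moreover have "regs(r := IntW (16 * x), 31 := y, r := z) = regs(31 := y, r := z)" for y z
    by auto
  ultimately show ?thesis
    using assms B_ge n_ge_2 length_mem by (simp add: fetch_def fun_upd_twist)
qed

lemma floor_log_le: "floor_log i \<le> i"
proof (cases "i = 0")
  case False
  then have "2 ^ floor_log i \<le> i" by (simp add: floor_log_exp2_le)
  then show ?thesis using less_exp[of "floor_log i"] by linarith
qed simp

lemma fits_mem: "x \<in> set mem \<Longrightarrow> fits_word B x"
proof -
  assume "x \<in> set mem"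
  then obtain y where y: "y < 16 * n" "x = entry (y div 16) ! (y mod 16)"
    by (auto simp: mem_def)
  then have i: "y div 16 < n" by (simp add: div_less_iff_less_mult mult.commute)
  have "length (entry (y div 16)) = 16" by (simp add: entry_def)
  then have "x \<in> set (entry (y div 16))"
    using y(2) by simp
  moreover have "n < B" using B_ge n_ge_2 by linarith
  moreover have "2 ^ (y div 16) < B" if "y div 16 < L"
  proof -
    have "(2::nat) ^ (y div 16) \<le> 2 ^ L" using that by (intro power_increasing) auto
    then show ?thesis using two_L_le \<open>n < B\<close> by linarith
  qed
  moreover have "set_encode (minima L D (y div 16)) < B"
    using set_encode_less[OF minima_subset[OF L_pos]] two_L_le \<open>n < B\<close>
    by (meson less_le_trans order.strict_trans1 less_trans)
  moreover have "floor_log (y div 16) < B" "L < B" "pos (y div 16) < B" "lowest_bit (y div 16) mod n < B"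
    using floor_log_le[of "y div 16"] i L_less pos_less[OF i] \<open>n < B\<close>
      mod_less_divisor[of n "lowest_bit (y div 16)"] n_ge_2
    by linarith+
  ultimately show ?thesis
    using n_ge_2 B_ge by (auto simp: entry_def)
qed

definition answer :: "nat \<Rightarrow> nat \<Rightarrow> real \<Rightarrow> real" where
  "answer u v r =
    (let r' = if is_s u then r else min r (a u) in if is_t v then r' else min r' (b v))"

lemma sem_finish:
  assumes "regs 0 = IntW u" "regs 1 = IntW v" "regs 2 = RealW d" "regs 5 = RealW m"
    "regs 6 = IntW 1" "u < n" "v < n"
  shows "sem B mem finish regs = Some (RealW (answer u v (m + d)))"
  using assms
  by (simp add: finish_def Let_def sem_fetch sem_min_into entry_def answer_def)

lemma sem_same_block:
  assumes "regs 0 = IntW u" "regs 1 = IntW v" "regs 2 = RealW d" "regs 6 = IntW 1" "u < n" "v < n"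
    "regs 3 = IntW i" "regs 4 = IntW j" "regs 7 = IntW L" "i \<le> j" "j < n" "i div L = j div L"
  shows "sem B mem same_block regs = Some (RealW (answer u v (rmin D i j + d)))"
proof -
  define z where "z = set_encode (minima L D j) div 2 ^ (i mod L)"
  have i: "i mod L < L" using L_pos by simp
  then have i': "i mod L < n" using L_less by linarith
  have z: "z < n"
    unfolding z_def using set_encode_less[OF minima_subset[OF L_pos]] two_L_le
    by (meson div_le_dividend le_less_trans less_le_trans)
  have q: "i + lowest_bit z \<le> j" "D (i + lowest_bit z) = rmin D i j"
    using lowest_bit_minima[OF L_pos assms(10,12) z_def[THEN arg_cong[of _ _ "\<lambda>z. i + lowest_bit z"]]]
    by auto
  have "n \<le> B" using B_ge n_ge_2 by linarith
  then have "i + lowest_bit z < B" "i mod L < B" "z < B"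
    using q(1) assms(11) z i' by linarith+
  then show ?thesis
    using assms i i' z q
    by (simp add: same_block_def sem_fetch sem_finish entry_def z_def[symmetric])
qed

lemma sem_across_blocks:
  assumes "regs 0 = IntW u" "regs 1 = IntW v" "regs 2 = RealW d" "regs 6 = IntW 1" "u < n" "v < n"
    "regs 3 = IntW i" "regs 4 = IntW j" "regs 7 = IntW L" "regs 8 = IntW (i div L)"
    "regs 9 = IntW (j div L)" "i < n" "j < n" "i div L < j div L"
  shows "sem B mem across_blocks regs = Some (RealW (answer u v (rmin D i j + d)))"
proof -
  define p q where "p = Suc (i div L)" and "q = j div L"
  have pq: "p \<le> q" using assms(14) by (simp add: p_def q_def)
  have pL: "i div L * L + (L - Suc 0) = p * L - Suc 0"
    using L_pos by (simp add: p_def)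
  have i_le: "i \<le> p * L - 1"
    using div_mult_mod_eq[of i L] mod_less_divisor[OF L_pos, of i] unfolding p_def mult_Suc by linarith
  have qL: "q * L \<le> j" by (simp add: q_def)
  have pqL: "p * L \<le> q * L" using pq by simp
  have pL_pos: "0 < p * L" using L_pos by (simp add: p_def)
  have bounds: "p < B" "q < B"
  proof -
    have "q \<le> j" by (simp add: q_def)
    then show "p < B" "q < B" using pq assms(13) B_ge by linarith+
  qed
  have same: "rmin D i j = min (rmin D i (p * L - 1)) (rmin D (q * L) j)" if "q \<le> p"
    using that pq i_le qL pL_pos by (intro rmin_cover) auto
  show ?thesis
  proof (cases "q \<le> p")
    case True
    then show ?thesis
      using assms bounds same
      by (simp add: across_blocks_def sem_fetch sem_min_into sem_finish entry_def pL
          p_def[symmetric] q_def[symmetric])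
  next
    case False
    define k where "k = floor_log (q - p)"
    have k: "2 ^ k \<le> q - p" "q - p < 2 * 2 ^ k"
      using False floor_log_exp2_le[of "q - p"] floor_log_exp2_gt[of "q - p"] by (auto simp: k_def)
    \<comment> \<open>This leaves room for the exponent \<open>k\<close> among the \<open>L\<close>
      offsets of a block. For \<open>L = 1\<close> the bound relies on \<open>p\<close> being at
      least 1.\<close>
    have "q - p < 2 ^ L"
    proof (cases "L = 1")
      case True
      then show ?thesis
        using n_less_two_L assms(13) qL by (simp add: p_def)
    next
      case False
      then have "q * 2 \<le> q * L" using L_pos by (intro mult_left_mono) auto
      then show ?thesis using qL assms(13) n_less_two_L by linarith
    qed
    then have "(2::nat) ^ k < 2 ^ L" using k(1) by linarith
    then have kL: "k < L" by simp
    define r where "r = q - 2 ^ k"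
    have r: "p \<le> r" "r + 2 ^ k = q" "r \<le> p + 2 ^ k" "p + 2 ^ k \<le> q" "r < q"
      using k False by (auto simp: r_def)
    have entries: "block_range_min L D (p * L + k) = rmin D (p * L) ((p + 2 ^ k) * L - 1)"
      "block_range_min L D (r * L + k) = rmin D (r * L) (q * L - 1)"
      using kL r(2) by (simp_all add: block_range_min_def)
    have idx: "x * L + k < n" "x * L < B" "x * L + k < B" if "x < q" for x
    proof -
      have "Suc x * L \<le> q * L" using that by (intro mult_right_mono) auto
      then have "x * L + k < n" using kL qL assms(13) by simp
      then show "x * L + k < n" "x * L < B" "x * L + k < B" using B_ge by linarith+
    qed
    have ranges: "q - p < n" "k < n" "p < q" "q - p < B" "r < B"
    proof -
      have "q \<le> j" by (simp add: q_def)
      then show "q - p < n" "k < n" "p < q" "q - p < B" "r < B"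
        using assms(13) kL L_less False bounds(2) r(5) by linarith+
    qed
    have le: "p * L \<le> r * L" "r * L \<le> (p + 2 ^ k) * L" "(p + 2 ^ k) * L \<le> q * L" "r * L < q * L"
      using r L_pos by simp_all
    have "rmin D i j = min (rmin D i (p * L - 1)) (rmin D (p * L) j)"
      using i_le qL pqL pL_pos by (intro rmin_cover) linarith+
    also have "rmin D (p * L) j = min (rmin D (p * L) (q * L - 1)) (rmin D (q * L) j)"
      using le qL by (intro rmin_cover) linarith+
    also have "rmin D (p * L) (q * L - 1) =
        min (rmin D (p * L) ((p + 2 ^ k) * L - 1)) (rmin D (r * L) (q * L - 1))"
    proof (rule rmin_cover)
      have "p * L < (p + 2 ^ k) * L" using L_pos by simp
      then show "p * L \<le> (p + 2 ^ k) * L - 1" by linarith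
    qed (use le in linarith)+
    finally have "rmin D i j =
        min (min (min (rmin D i (p * L - 1)) (rmin D (q * L) j)) (block_range_min L D (p * L + k)))
          (block_range_min L D (r * L + k))"
      unfolding entries by (simp add: min.assoc min.commute min.left_commute)
    then show ?thesis
      using assms bounds False ranges kL idx[OF ranges(3)] idx[OF r(5)]
      by (simp add: across_blocks_def sem_fetch sem_min_into sem_finish entry_def pL
          p_def[symmetric] q_def[symmetric] k_def[symmetric] r_def[symmetric])
  qed
qed

lemma sem_query:
  assumes "regs 0 = IntW u" "regs 1 = IntW v" "regs 2 = RealW d" "u < n" "v < n"
  shows "sem B mem query regs = Some (RealW
    (if pos v \<le> pos u then f0 else answer u v (Min (D ` {pos u..<pos v}) + d)))"
proof (cases "pos v \<le> pos u")
  case True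
  then show ?thesis
    using assms by (simp add: query_def sem_fetch entry_def)
next
  case False
  define j where "j = pos v - Suc 0"
  have j: "pos u \<le> j" "j < n" using False pos_less[OF assms(5)] by (auto simp: j_def)
  have less_B: "x < B" if "x < n" for x
    using that B_ge by linarith
  have "{pos u..<pos v} = {pos u..j}" using False by (auto simp: j_def)
  then have m: "Min (D ` {pos u..<pos v}) = rmin D (pos u) j" by (simp add: rmin_def)
  have div: "pos u div L < n" "j div L < n" "pos u div L \<le> j div L"
    using div_le_dividend[of "pos u" L] div_le_dividend[of j L] j div_le_mono[OF j(1), of L] by linarith+
  show ?thesis
  proof (cases "j div L \<le> pos u div L")
    case True
    then have "pos u div L = j div L" using div by simp
    then show ?thesis
      using False assms div j less_B B_ge m
      by (simp add: query_def sem_fetch entry_def j_def[symmetric] sem_same_block)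
  next
    case neq: False
    then show ?thesis
      using False assms div j less_B B_ge m pos_less[OF assms(4)]
      by (simp add: query_def sem_fetch entry_def j_def[symmetric] sem_across_blocks)
  qed
qed

lemma run_query_code:
  assumes "u < n" "v < n"
  shows "run_query B mem (compile 0 query) (Suc (size query)) u v d = Some (RealW
    (if pos v \<le> pos u then f0 else answer u v (Min (D ` {pos u..<pos v}) + d)))"
  unfolding run_query_def using run_compile[of query "Suc (size query)" B mem "[]" "[]"]
  by (simp add: sem_query assms)

end

section \<open>Correctness of the oracle\<close>

lemma (in st_net) oracle_exists:
  assumes num: "bij_betw num (pverts G) {..<card (pverts G)}"
  shows "\<exists>mem. length mem = 16 * card (pverts G) \<and>
    mincut_sensitivity_oracle (card (pverts G) ^ 5) (compile 0 query) (Suc (size query)) G w s t num mem"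
proof -
  define vert where "vert = inv_into (pverts G) num"
  obtain pos :: "'a \<Rightarrow> nat" and D :: "nat \<Rightarrow> real" where
    pos: "\<And>v. v \<in> pverts G \<Longrightarrow> pos v < card (pverts G)" and
    vital_pos: "\<And>e. vital e \<Longrightarrow> pos (fst e) < pos (snd e)" and
    vital_D: "\<And>e. vital e \<Longrightarrow> \<exists>C. mincut_for e C \<and> Min (D ` {pos (fst e)..<pos (snd e)}) = cap C" and
    nonvital_D: "\<And>e. e \<in> parcs G \<Longrightarrow> pos (fst e) < pos (snd e) \<Longrightarrow> \<not> vital e \<Longrightarrow>
       fmin + w e \<le> Min (D ` {pos (fst e)..<pos (snd e)})"
    by (rule vertex_order) (rule that)
  define n where "n = card (pverts G)"
  have num_less: "num v < n" and vert_num: "vert (num v) = v" if "v \<in> pverts G" for v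
    using that num bij_betw_inv_into_left[OF num] bij_betwE[OF num] by (auto simp: n_def vert_def)
  have vert_in: "vert i \<in> pverts G" if "i < n" for i
    using that bij_betwE[OF bij_betw_inv_into[OF num]] by (auto simp: n_def vert_def)
  \<comment> \<open>Two distinct terminals give \<open>2 \<le> n\<close>, as the tables
    require.\<close>
  have "card {s, t} \<le> n"
    unfolding n_def using s_vert t_vert by (intro card_mono finite_verts) auto
  then interpret tables n "\<lambda>i. pos (vert i)" D fmin "\<lambda>i. vert i = s" "\<lambda>i. vert i = t"
      "\<lambda>i. min_excluding (vert i)" "\<lambda>i. min_including (vert i)"
    using s_neq_t pos[folded n_def] vert_in by unfold_locales auto
  have "run_query (n ^ 5) mem (compile 0 query) (Suc (size query)) (num (fst e)) (num (snd e)) d =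
      Some (RealW (mincut_capacity G (w(e := w e + d)) s t))"
    if e: "e \<in> parcs G" and d: "- w e \<le> d" for e d
  proof -
    have verts: "fst e \<in> pverts G" "snd e \<in> pverts G" using arc_verts[OF e] by auto
    note nums = num_less[OF verts(1)] num_less[OF verts(2)] vert_num[OF verts(1)] vert_num[OF verts(2)]
    show ?thesis
    proof (cases "pos (snd e) \<le> pos (fst e)")
      case True
      then have "\<not> vital e" using vital_pos[of e] by auto
      then show ?thesis
        using True mincut_capacity_nonvital[OF e _ d] by (simp add: run_query_code nums)
    next
      case False
      then have "mincut_capacity G (w(e := w e + d)) s t =
          answer (num (fst e)) (num (snd e)) (Min (D ` {pos (fst e)..<pos (snd e)}) + d)"
        unfolding answer_def Let_def nums
        using nonvital_D[OF e] vital_D[of e] by (intro mincut_capacity_change[OF e d]) auto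
      then show ?thesis
        using False by (simp add: run_query_code nums)
    qed
  qed
  then show ?thesis
    using length_mem fits_mem unfolding mincut_sensitivity_oracle_def n_def[symmetric]
    by (intro exI[of _ mem]) blast
qed

theorem theorem8:
  shows "\<exists>(P :: instr list) (time :: nat) (c :: nat) (b :: nat).
    \<forall>(G :: 'a pair_pre_digraph) w s t num.
      st_network G w s t \<longrightarrow> bij_betw num (pverts G) {..<card (pverts G)} \<longrightarrow>
      (\<exists>mem. length mem \<le> c * card (pverts G) \<and>
             mincut_sensitivity_oracle (card (pverts G) ^ b) P time G w s t num mem)"
proof (rule exI[of _ "compile 0 query"], rule exI[of _ "Suc (size query)"], rule exI[of _ 16],
    rule exI[of _ 5], intro allI impI)
  fix G :: "'a pair_pre_digraph" and w s t num
  assume "st_network G w s t" and num: "bij_betw num (pverts G) {..<card (pverts G)}"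
  then interpret st_net G w s t by unfold_locales
  show "\<exists>mem. length mem \<le> 16 * card (pverts G) \<and>
      mincut_sensitivity_oracle (card (pverts G) ^ 5) (compile 0 query) (Suc (size query)) G w s t num mem"
    using oracle_exists[OF num] by (metis order_refl)
qed

end
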